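(* There exists a unique $\mathbf{Z}$-linear map $\delta:\mathbf{Z}^{(\mathcal{B})}\to\mathbf{Z}^{(\mathcal{A})}$, graded of degree $0$ for the weight (i.e. $\delta(\mathbf{Z}^{\mathcal{B}_k})\subset\mathbf{Z}^{\mathcal{A}_k}$ for all $k\geqslant 0$), such that $\delta([\varnothing])=\varnothing$ and $\mu\circ\delta^*=\delta\circ\alpha$, where $\delta^*:\mathbf{Z}^{(\mathcal{B}^* )}\to\mathbf{Z}^{(\mathcal{A}^* )}$ is the map induced by $\delta$. Equivalently, $\delta([\mathbf{a}])^{\rm init}=\delta([\mathbf{a}^{\rm init}])+\delta([\mathbf{a}^{\rm mid}])+\delta([\mathbf{a}^{\rm fin}])$ for every non-empty admissible composition $\mathbf{a}$.
   Context: A composition is a finite sequence $\mathbf{a}=(a_1,\ldots,a_r)$ of positive integers ($r\geqslant 0$); $r$ is its depth and $|\mathbf{a}|=a_1+\cdots+a_r$ its weight. It is admissible if $r=0$ or $a_1\geqslant 2$. $\mathcal{A}$ is the set of admissible compositions, $\mathcal{A}^*=\mathcal{A}\setminus\{\varnothing\}$, $\mathcal{A}_k$ those of weight $k$. The binary word of $\mathbf{a}$ is $\mathbf{w}(\mathbf{a})=0^{a_1-1}1\,0^{a_2-1}1\cdots0^{a_r-1}1$ (where $0^u$ denotes $u$ zeros); $\mathbf{w}$ is a bijection from compositions onto words in $\{0,1\}$ not ending in $0$. The dual of a word $\varepsilon_1\cdots\varepsilon_k$ is $\overline{\varepsilon_k}\cdots\overline{\varepsilon_1}$ with $\overline{0}=1,\overline{1}=0$;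 for $\mathbf{a}$ admissible, the dual composition $\overline{\mathbf{a}}$ is the admissible composition whose word is dual to $\mathbf{w}(\mathbf{a})$. $\mathcal{B}$ is the quotient of $\mathcal{A}$ by $\mathbf{a}\sim\overline{\mathbf{a}}$, $[\mathbf{a}]$ the class of $\mathbf{a}$, $\mathcal{B}_k$ the classes of weight $k$, $\mathcal{B}^*=\mathcal{B}\setminus\{[\varnothing]\}$. $\mathbf{Z}^{(X)}$ is the free $\mathbf{Z}$-module on $X$. For a composition $\mathbf{a}=(a_1,\ldots,a_r)$, $\mathbf{a}^{\rm init}=(a_1,\ldots,a_{r-1})$ if $r\geqslant1$ and $\varnothing^{\rm init}=\varnothing$. For admissible $\mathbf{a}$, $\mathbf{a}^{\rm fin}$ is the dual of $(\overline{\mathbf{a}})^{\rm init}$ and $\mathbf{a}^{\rm mid}=(\mathbf{a}^{\rm fin})^{\rm init}$; these maps are extended $\mathbf{Z}$-linearly. $\mu:\mathbf{Z}^{(\mathcal{A}^* )}\to\mathbf{Z}^{(\mathcal{A})}$ is the $\mathbf{Z}$-linear map $\mathbf{a}\mapsto\mathbf{a}^{\rm init}$. $\alpha:\mathbf{Z}^{(\mathcal{B}^* )}\to\mathbf{Z}^{(\mathcal{B})}$ is the $\mathbf{Z}$-linear map sending $[\mathbf{a}]$ to $[\mathbf{a}^{\rm init}]+[\mathbf{a}^{\rm mid}]+[\mathbf{a}^{\rm fin}]$ (this is well defined, i.e. independent of the representative). *)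

theory Defs
  imports Complex_Main "HOL-Library.Poly_Mapping" "HOL-Library.FuncSet"
begin

section \<open>Compositions, binary words and duality\<close>

definition composition :: "nat list \<Rightarrow> bool" where
  "composition a \<longleftrightarrow> (\<forall>n\<in>set a. 1 \<le> n)"

definition admissible :: "nat list \<Rightarrow> bool" where
  "admissible a \<longleftrightarrow> composition a \<and> (a = [] \<or> 2 \<le> hd a)"

text \<open>Binary words are lists of booleans, with \<open>False\<close> for the letter 0 and \<open>True\<close> for the letter 1.\<close>

definition word :: "nat list \<Rightarrow> bool list" where
  "word a = concat (map (\<lambda>n. replicate (n - 1) False @ [True]) a)"

definition dual_word :: "bool list \<Rightarrow> bool list" where
  "dual_word w = rev (map Not w)"

definition dual_comp :: "nat list \<Rightarrow> nat list" where
  "dual_comp a = (THE b. admissible b \<and> word b = dual_word (word a))"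

lemma word_Nil [simp]: "word [] = []"
  and word_Cons [simp]: "word (n # a) = replicate (n - 1) False @ True # word a"
  and word_append [simp]: "word (a @ b) = word a @ word b"
  by (simp_all add: word_def)

lemma word_eq_Nil_iff [simp]: "word a = [] \<longleftrightarrow> a = []"
  by (cases a) auto

lemma dual_word_dual_word [simp]: "dual_word (dual_word w) = w"
  by (simp add: dual_word_def rev_map comp_def)

lemma dual_word_eq_Nil_iff [simp]: "dual_word w = [] \<longleftrightarrow> w = []"
  by (simp add: dual_word_def)

lemma last_word: "a \<noteq> [] \<Longrightarrow> last (word a)"
  by (cases a rule: rev_cases) auto

lemma replicate_False_True_inject:
  "replicate m False @ True # u = replicate n False @ True # v \<longleftrightarrow> m = n \<and> u = v"
proof (induction m arbitrary: n)
  case 0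
  then show ?case by (cases n) auto
next
  case (Suc m)
  then show ?case by (cases n) auto
qed

lemma word_inject:
  assumes "composition a" "composition b" "word a = word b"
  shows "a = b"
  using assms
proof (induction a arbitrary: b)
  case Nil
  then show ?case using word_eq_Nil_iff[of b] by simp
next
  case (Cons n a)
  then obtain m c where b: "b = m # c"
    by (cases b) auto
  have eq: "n - 1 = m - 1" "word a = word c"
    using Cons.prems(3) unfolding b by (simp_all add: replicate_False_True_inject)
  have "composition a" "composition c" "1 \<le> n" "1 \<le> m"
    using Cons.prems(1,2) unfolding b by (simp_all add: composition_def)
  with Cons.IH[of c] eq b show ?case by simp
qed

lemma word_surject:
  assumes "w = [] \<or> last w"
  shows "\<exists>a. composition a \<and> word a = w"
  using assms
proof (induction w rule: list.induct)
  case Nil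
  show ?case by (rule exI[of _ "[]"]) (simp add: composition_def)
next
  case (Cons x w)
  then obtain a where a: "composition a" "word a = w"
    by (auto split: if_splits)
  show ?case
  proof (cases x)
    case True
    then show ?thesis using a
      by (intro exI[of _ "1 # a"]) (auto simp: composition_def)
  next
    case False
    with Cons.prems a obtain n b where "a = n # b" by (cases a) auto
    then show ?thesis using a False
      by (intro exI[of _ "Suc n # b"]) (cases n; auto simp: composition_def)
  qed
qed

lemma admissible_iff_word:
  assumes "composition a"
  shows "admissible a \<longleftrightarrow> a = [] \<or> \<not> hd (word a)"
proof (cases a)
  case Nil
  then show ?thesis using assms by (simp add: admissible_def)
next
  case (Cons n b)
  then show ?thesis using assms
    by (cases "n - 1") (auto simp: admissible_def composition_def)
qed

lemma ex1_dual:
  assumes "admissible a"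
  shows "\<exists>!b. admissible b \<and> word b = dual_word (word a)"
proof -
  have comp: "composition a" using assms by (simp add: admissible_def)
  have "dual_word (word a) = [] \<or> last (dual_word (word a))"
    using assms admissible_iff_word[OF comp]
    by (cases "a = []") (simp_all add: dual_word_def last_rev hd_map)
  then obtain b where b: "composition b" "word b = dual_word (word a)"
    using word_surject by blast
  have "b = [] \<or> \<not> hd (word b)"
  proof (cases "a = []")
    case True
    then show ?thesis using b by (simp flip: word_eq_Nil_iff)
  next
    case False
    then show ?thesis using b last_word[OF False]
      by (simp add: dual_word_def hd_rev last_map)
  qed
  with b have "admissible b" by (simp add: admissible_iff_word)
  with b show ?thesis
    by (metis admissible_def word_inject)
qed

lemma
  assumes "admissible a"
  shows admissible_dual_comp: "admissible (dual_comp a)"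
    and word_dual_comp: "word (dual_comp a) = dual_word (word a)"
  using theI'[OF ex1_dual[OF assms]] by (simp_all add: dual_comp_def)

lemma dual_comp_dual_comp: "admissible a \<Longrightarrow> dual_comp (dual_comp a) = a"
  by (metis admissible_def admissible_dual_comp dual_word_dual_word word_dual_comp word_inject)

lemma admissible_butlast: "admissible a \<Longrightarrow> admissible (butlast a)"
  by (cases a) (auto simp: admissible_def composition_def dest: in_set_butlastD)

lemma length_word: "composition a \<Longrightarrow> length (word a) = sum_list a"
  by (induction a) (auto simp: composition_def)

lemma sum_list_dual_comp: "admissible a \<Longrightarrow> sum_list (dual_comp a) = sum_list a"
  by (metis admissible_def admissible_dual_comp dual_word_def length_map length_rev length_word
      word_dual_comp)

lemma dual_comp_butlast_dual_comp_Cons: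
  assumes adm: "admissible (n # a)"
  shows "dual_comp (butlast (dual_comp (n # a)))
       = (if n = 2 then dropWhile ((=) 1) a else (n - 1) # a)" (is "_ = ?f")
proof -
  have comp: "composition a" and n: "2 \<le> n"
    using adm by (auto simp: admissible_def composition_def)
  have cut: "dual_word (word (butlast b)) = dropWhile id (tl (dual_word (word b)))" for b
  proof (cases b rule: rev_cases)
    case Nil
    then show ?thesis by (simp add: dual_word_def)
  next
    case (snoc c m)
    have "dropWhile id (dual_word (word c)) = dual_word (word c)"
      by (cases c rule: rev_cases) (auto simp: dual_word_def)
    moreover have "tl (dual_word (word b)) = replicate (m - 1) True @ dual_word (word c)"
      using snoc by (simp add: dual_word_def)
    moreover have "dropWhile id (replicate k True @ v) = dropWhile id v" for k v
      by (induction k) auto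
    ultimately show ?thesis using snoc by simp
  qed
  have drop: "word (dropWhile ((=) 1) a) = dropWhile id (word a)"
    using comp
  proof (induction a)
    case (Cons m a)
    then show ?case by (cases "m - 1") (auto simp: composition_def)
  qed simp
  have adm1: "admissible ?f"
  proof (cases "n = 2")
    case True
    have sub: "composition (dropWhile ((=) 1) a)"
      using comp by (auto simp: composition_def dest: set_dropWhileD)
    have "dropWhile ((=) 1) a = [] \<or> 2 \<le> hd (dropWhile ((=) 1) a)"
    proof (cases "dropWhile ((=) 1) a = []")
      case False
      then have "hd (dropWhile ((=) 1) a) \<noteq> 1"
        using hd_dropWhile by metis
      moreover have "1 \<le> hd (dropWhile ((=) 1) a)"
        using sub False by (simp add: composition_def)
      ultimately show ?thesis by linarith
    qed simp
    with sub True show ?thesis by (simp add: admissible_def)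
  next
    case False
    then show ?thesis using n comp by (auto simp: admissible_def composition_def)
  qed
  have "word ?f = dropWhile id (tl (word (n # a)))"
  proof -
    obtain k where "n = Suc (Suc k)" using n by (metis add_2_eq_Suc le_Suc_ex)
    then show ?thesis by (cases k) (auto simp: drop[simplified])
  qed
  also have "\<dots> = word (dual_comp (butlast (dual_comp (n # a))))"
    by (simp add: adm admissible_butlast admissible_dual_comp cut word_dual_comp del: word_Cons)
  finally have "word ?f = word (dual_comp (butlast (dual_comp (n # a))))" .
  moreover have "admissible (dual_comp (butlast (dual_comp (n # a))))"
    using adm by (intro admissible_butlast admissible_dual_comp)
  ultimately have "?f = dual_comp (butlast (dual_comp (n # a)))"
    using adm1 unfolding admissible_def by (blast intro: word_inject)
  then show ?thesis by (rule sym)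
qed

lemma dual_comp_Nil: "dual_comp [] = []"
proof -
  have "admissible []" by (simp add: admissible_def composition_def)
  from word_dual_comp[OF this] have "word (dual_comp []) = []"
    by (simp add: dual_word_def)
  then show ?thesis by simp
qed

lemma butlast_dual_comp_butlast_dual_comp:
  assumes "admissible a"
  shows "butlast (dual_comp (butlast (dual_comp a))) = dual_comp (butlast (dual_comp (butlast a)))"
proof (cases a)
  case Nil
  then show ?thesis using Nil by (simp add: dual_comp_Nil)
next
  case (Cons n b)
  have drop: "butlast (dropWhile ((=) 1) c) = dropWhile ((=) 1) (butlast c)" for c :: "nat list"
    by (induction c) auto
  show ?thesis
  proof (cases "b = []")
    case True
    then show ?thesis using Cons assms by (simp add: dual_comp_Nil dual_comp_butlast_dual_comp_Cons)
  next
    case False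
    then have eq: "butlast a = n # butlast b" using Cons by simp
    then have "admissible (n # butlast b)" using assms admissible_butlast by metis
    then show ?thesis using Cons assms False
      by (simp add: dual_comp_butlast_dual_comp_Cons drop[simplified])
  qed
qed

section \<open>Admissible compositions and their classes under duality\<close>

typedef adm = "{a. admissible a}"
  by (rule exI[of _ "[]"]) (simp add: admissible_def composition_def)

setup_lifting type_definition_adm

lift_definition empty_adm :: adm is "[]"
  by (simp add: admissible_def composition_def)

lift_definition weight :: "adm \<Rightarrow> nat" is sum_list .

lift_definition dual :: "adm \<Rightarrow> adm" is dual_comp
  by (rule admissible_dual_comp)

lift_definition init :: "adm \<Rightarrow> adm" is butlast
  by (rule admissible_butlast)

definition fin :: "adm \<Rightarrow> adm" where
  "fin a = dual (init (dual a))"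

definition mid :: "adm \<Rightarrow> adm" where
  "mid a = init (fin a)"

lemma dual_dual [simp]: "dual (dual a) = a"
  by transfer (rule dual_comp_dual_comp)

lemma weight_dual [simp]: "weight (dual a) = weight a"
  by transfer (rule sum_list_dual_comp)

lemma mid_dual: "mid (dual a) = dual (mid a)"
proof -
  have "init (fin a) = fin (init a)"
    unfolding fin_def by transfer (rule butlast_dual_comp_butlast_dual_comp)
  then show ?thesis by (simp add: mid_def fin_def)
qed

lemma weight_eq_0_iff: "weight a = 0 \<longleftrightarrow> a = empty_adm"
proof (transfer, safe)
  fix a assume "admissible a" "sum_list a = 0"
  then show "a = []" by (cases a) (auto simp: admissible_def)
qed auto

lifting_forget adm.lifting

quotient_type adm_class = adm / "\<lambda>a b. b = a \<or> b = dual a"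
  by (rule equivpI) (auto simp: reflp_def symp_def transp_def)

lift_definition cls :: "adm \<Rightarrow> adm_class" is "\<lambda>a. a" .

lift_definition class_weight :: "adm_class \<Rightarrow> nat" is weight by auto

lemma cls_eq_iff: "cls a = cls b \<longleftrightarrow> b = a \<or> b = dual a"
  by transfer auto

lemma class_weight_cls [simp]: "class_weight (cls a) = weight a"
  by transfer (rule refl)

lemma class_cases: obtains a where "c = cls a"
  by transfer auto

lemma cls_dual [simp]: "cls (dual a) = cls a"
  by (simp add: cls_eq_iff)

section \<open>Free modules and the maps \<open>\<mu>\<close> and \<open>\<alpha>\<close>\<close>

text \<open>The free \<open>\<int>\<close>-module on a type \<open>'a\<close> is \<open>'a \<Rightarrow>\<^sub>0 int\<close>; the free module on a subset is
  the submodule of elements supported there.\<close>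

definition free_on :: "'a set \<Rightarrow> ('a \<Rightarrow>\<^sub>0 int) set" where
  "free_on S = {x. Poly_Mapping.keys x \<subseteq> S}"

definition Adm_star :: "adm set" where
  "Adm_star = UNIV - {empty_adm}"

definition Class_star :: "adm_class set" where
  "Class_star = UNIV - {cls empty_adm}"

definition Adm_wt :: "nat \<Rightarrow> adm set" where
  "Adm_wt k = {a. weight a = k}"

definition Class_wt :: "nat \<Rightarrow> adm_class set" where
  "Class_wt k = {c. class_weight c = k}"

definition init_lin :: "(adm \<Rightarrow>\<^sub>0 int) \<Rightarrow> (adm \<Rightarrow>\<^sub>0 int)" where
  "init_lin = frag_extend (\<lambda>a. frag_of (init a))"

definition mu :: "(adm \<Rightarrow>\<^sub>0 int) \<Rightarrow> (adm \<Rightarrow>\<^sub>0 int)" where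
  "mu = restrict init_lin (free_on Adm_star)"

lift_definition alpha_class :: "adm_class \<Rightarrow> (adm_class \<Rightarrow>\<^sub>0 int)" is
  "\<lambda>a. frag_of (cls (init a)) + frag_of (cls (mid a)) + frag_of (cls (fin a))"
proof -
  fix a b :: adm
  assume "b = a \<or> b = dual a"
  moreover have "cls (init (dual a)) = cls (fin a)" "cls (fin (dual a)) = cls (init a)"
    "cls (mid (dual a)) = cls (mid a)"
    using cls_dual[of "init (dual a)"] by (simp_all add: fin_def mid_dual)
  ultimately show "frag_of (cls (init a)) + frag_of (cls (mid a)) + frag_of (cls (fin a))
    = frag_of (cls (init b)) + frag_of (cls (mid b)) + frag_of (cls (fin b))"
    by (auto simp: algebra_simps)
qed

lemma alpha_class_cls:
  "alpha_class (cls a) = frag_of (cls (init a)) + frag_of (cls (mid a)) + frag_of (cls (fin a))"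
  by transfer (rule refl)

definition alpha :: "(adm_class \<Rightarrow>\<^sub>0 int) \<Rightarrow> (adm_class \<Rightarrow>\<^sub>0 int)" where
  "alpha = restrict (frag_extend alpha_class) (free_on Class_star)"

definition Z_linear :: "(('a \<Rightarrow>\<^sub>0 int) \<Rightarrow> ('b \<Rightarrow>\<^sub>0 int)) \<Rightarrow> bool" where
  "Z_linear f \<longleftrightarrow> module_hom frag_cmul frag_cmul f"

definition graded :: "((adm_class \<Rightarrow>\<^sub>0 int) \<Rightarrow> (adm \<Rightarrow>\<^sub>0 int)) \<Rightarrow> bool" where
  "graded \<delta> \<longleftrightarrow> (\<forall>k. \<delta> ` free_on (Class_wt k) \<subseteq> free_on (Adm_wt k))"

text \<open>The map \<open>\<delta>\<^sup>*\<close> induced by \<open>\<delta>\<close>; by \<open>induced_mem\<close> below it takes values in the free module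
  on the non-empty admissible compositions whenever \<open>\<delta>\<close> is linear and graded.\<close>

definition induced :: "((adm_class \<Rightarrow>\<^sub>0 int) \<Rightarrow> (adm \<Rightarrow>\<^sub>0 int)) \<Rightarrow>
    (adm_class \<Rightarrow>\<^sub>0 int) \<Rightarrow> (adm \<Rightarrow>\<^sub>0 int)" where
  "induced \<delta> = restrict \<delta> (free_on Class_star)"

lemma module_frag_cmul: "module frag_cmul"
  by unfold_locales (simp_all add: frag_cmul_distrib frag_cmul_distrib2)

lemma Z_linear_iff:
  "Z_linear f \<longleftrightarrow> (\<forall>x y. f (x + y) = f x + f y) \<and> (\<forall>c x. f (frag_cmul c x) = frag_cmul c (f x))"
  by (simp add: Z_linear_def module_hom_iff module_frag_cmul)

lemma induced_mem:
  assumes lin: "Z_linear \<delta>" and gr: "graded \<delta>"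
  shows "induced \<delta> \<in> free_on Class_star \<rightarrow> free_on Adm_star"
proof
  fix x assume x: "x \<in> free_on Class_star"
  then have "Poly_Mapping.keys x \<subseteq> Class_star" by (simp add: free_on_def)
  then have "\<delta> x \<in> free_on Adm_star"
  proof (induction x rule: frag_induction)
    case zero
    have "\<delta> (frag_cmul 0 0) = frag_cmul 0 (\<delta> 0)"
      using lin unfolding Z_linear_iff by blast
    then have "\<delta> 0 = 0" by simp
    then show ?case by (simp add: free_on_def)
  next
    case (one c)
    have "class_weight c \<noteq> 0"
      using one by (cases c rule: class_cases) (auto simp: Class_star_def weight_eq_0_iff)
    then have "Adm_wt (class_weight c) \<subseteq> Adm_star"
      using weight_eq_0_iff[of empty_adm] by (auto simp: Adm_wt_def Adm_star_def)
    moreover have "frag_of c \<in> free_on (Class_wt (class_weight c))"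
      by (simp add: free_on_def Class_wt_def)
    then have "\<delta> (frag_of c) \<in> free_on (Adm_wt (class_weight c))"
      using gr unfolding graded_def by blast
    ultimately show ?case
      by (auto simp: free_on_def)
  next
    case (diff a b)
    have "\<delta> (a + frag_cmul (- 1) b) = \<delta> a + \<delta> (frag_cmul (- 1) b)"
      "\<delta> (frag_cmul (- 1) b) = frag_cmul (- 1) (\<delta> b)"
      using lin unfolding Z_linear_iff by blast+
    then have "\<delta> (a - b) = \<delta> a - \<delta> b" by simp
    then show ?case using diff keys_diff[of "\<delta> a" "\<delta> b"] unfolding free_on_def mem_Collect_eq
      by (metis Un_least order_trans)
  qed
  then show "induced \<delta> x \<in> free_on Adm_star" using x by (simp add: induced_def)
qed

end

theory Submission
  imports Defs
begin

text \<open>For \<open>k \<ge> 2\<close> the map \<open>init\<close> is a bijection from the admissible compositions of weight \<open>k\<close>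
  onto those of weight less than \<open>k\<close>: the last part is recovered as the missing weight. As \<open>\<alpha>\<close>
  strictly lowers weights and there is nothing of weight 1, the equation \<open>\<mu> \<circ> \<delta>\<^sup>* = \<delta> \<circ> \<alpha>\<close> is
  therefore a recursion on the weight that determines \<open>\<delta>\<close> on each class.\<close>

section \<open>Weights of \<open>init\<close>, \<open>fin\<close> and \<open>mid\<close>\<close>

lemma Rep_adm_eq_Nil_iff: "Rep_adm a = [] \<longleftrightarrow> a = empty_adm"
  by (metis Rep_adm_inject empty_adm.rep_eq)

lemma weight_init_less:
  assumes "a \<noteq> empty_adm"
  shows "weight (init a) < weight a"
proof -
  have adm: "admissible (Rep_adm a)" using Rep_adm[of a] by simp
  obtain b n where "Rep_adm a = b @ [n]"
    using assms by (metis Rep_adm_eq_Nil_iff rev_exhaust)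
  with adm show ?thesis
    by (auto simp: weight.rep_eq init.rep_eq admissible_def composition_def)
qed

lemma init_empty [simp]: "init empty_adm = empty_adm"
  by (metis Rep_adm_inject empty_adm.rep_eq init.rep_eq butlast.simps(1))

lemma weight_init_le: "weight (init a) \<le> weight a"
  using weight_init_less[of a] by (cases "a = empty_adm") auto

lemma dual_eq_empty_iff: "dual a = empty_adm \<longleftrightarrow> a = empty_adm"
  by (metis weight_dual weight_eq_0_iff)

text \<open>\<open>fin\<close> is \<open>init\<close> conjugated by \<open>dual\<close>, and
  \<open>dual\<close> preserves both the weight and non-emptiness.\<close>

lemma weight_fin_less: "a \<noteq> empty_adm \<Longrightarrow> weight (fin a) < weight a"
  using weight_init_less[of "dual a"] by (simp add: fin_def dual_eq_empty_iff)

lemma weight_mid_less: "a \<noteq> empty_adm \<Longrightarrow> weight (mid a) < weight a"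
  using weight_fin_less[of a] weight_init_le[of "fin a"] by (simp add: mid_def)

text \<open>Admissibility already forces the first part to be at least 2.\<close>

lemma weight_ge_2:
  assumes "a \<noteq> empty_adm"
  shows "2 \<le> weight a"
proof -
  have adm: "admissible (Rep_adm a)" using Rep_adm[of a] by simp
  obtain b n where "Rep_adm a = n # b"
    using assms by (metis Rep_adm_eq_Nil_iff list.exhaust)
  with adm show ?thesis
    by (auto simp: weight.rep_eq admissible_def)
qed

section \<open>Inverting \<open>init\<close> in a fixed weight\<close>

lemma bij_betw_init:
  assumes k: "2 \<le> k"
  shows "bij_betw init (Adm_wt k) {c. weight c < k}"
proof (rule bij_betw_imageI)
  show "inj_on init (Adm_wt k)"
  proof (rule inj_onI)
    fix a b assume a: "a \<in> Adm_wt k" and b: "b \<in> Adm_wt k" and eq: "init a = init b"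
    \<comment> \<open>\<open>init\<close> fixes \<open>empty_adm\<close>, so a last part to recover
      exists only because the weight \<open>k\<close> is nonzero.\<close>
    have "Rep_adm a \<noteq> []" "Rep_adm b \<noteq> []"
      using a b k weight_eq_0_iff[of empty_adm] by (auto simp: Adm_wt_def Rep_adm_eq_Nil_iff)
    then obtain c m d n where "Rep_adm a = c @ [m]" "Rep_adm b = d @ [n]"
      by (metis rev_exhaust)
    moreover have "butlast (Rep_adm a) = butlast (Rep_adm b)"
      using eq by (metis init.rep_eq)
    moreover have "sum_list (Rep_adm a) = sum_list (Rep_adm b)"
      using a b by (simp add: Adm_wt_def weight.rep_eq)
    ultimately have "Rep_adm a = Rep_adm b" by simp
    then show "a = b" by (simp add: Rep_adm_inject)
  qed
  show "init ` Adm_wt k = {c. weight c < k}"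
  proof (intro equalityI subsetI)
    fix c assume "c \<in> init ` Adm_wt k"
    then obtain a where "weight a = k" "c = init a" by (auto simp: Adm_wt_def)
    moreover from this have "a \<noteq> empty_adm"
      using k weight_eq_0_iff[of a] by auto
    ultimately show "c \<in> {c. weight c < k}" by (auto intro: weight_init_less)
  next
    fix c assume "c \<in> {c. weight c < k}"
    then have c: "sum_list (Rep_adm c) < k" by (simp add: weight.rep_eq)
    define b where "b = Rep_adm c @ [k - sum_list (Rep_adm c)]"
    have "admissible (Rep_adm c)" using Rep_adm[of c] by simp
    \<comment> \<open>The appended part is positive because the weight of \<open>c\<close> is below
      \<open>k\<close>. If \<open>c\<close> is empty, it is also the first part, and
      \<open>[k]\<close> is admissible because \<open>2 \<le> k\<close>.\<close>
    then have "admissible b" using c k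
      by (cases "Rep_adm c") (auto simp: b_def admissible_def composition_def)
    then have rep: "Rep_adm (Abs_adm b) = b" by (simp add: Abs_adm_inverse)
    have "weight (Abs_adm b) = k"
      using c by (simp add: weight.rep_eq rep) (simp add: b_def)
    moreover have "init (Abs_adm b) = c"
      by (simp add: rep init.rep_eq flip: Rep_adm_inject) (simp add: b_def)
    ultimately show "c \<in> init ` Adm_wt k" by (auto simp: Adm_wt_def)
  qed
qed

text \<open>For \<open>2 \<le> k\<close> this is the inverse of \<open>init_lin\<close> from
  \<open>free_on {c. weight c < k}\<close> back to \<open>free_on (Adm_wt k)\<close>. Basis elements
  of weight at least \<open>k\<close> lie outside the image of \<open>init\<close>, and nothing is
  claimed about their values.\<close>

definition lift_init :: "nat \<Rightarrow> (adm \<Rightarrow>\<^sub>0 int) \<Rightarrow> (adm \<Rightarrow>\<^sub>0 int)" where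
  "lift_init k = frag_extend (\<lambda>c. frag_of (inv_into (Adm_wt k) init c))"

lemma frag_extend_frag_of_id_on:
  assumes "\<And>a. a \<in> Poly_Mapping.keys x \<Longrightarrow> f a = a"
  shows "frag_extend (\<lambda>a. frag_of (f a)) x = x"
proof -
  have "frag_extend (\<lambda>a. frag_of (f a)) x = frag_extend frag_of x"
    by (rule frag_extend_eq) (simp add: assms)
  then show ?thesis by (simp add: frag_expansion[symmetric])
qed

lemma frag_extend_frag_of_comp:
  "frag_extend (\<lambda>b. frag_of (g b)) (frag_extend (\<lambda>a. frag_of (f a)) x)
    = frag_extend (\<lambda>a. frag_of (g (f a))) x"
  using frag_extend_compose[of "\<lambda>b. frag_of (g b)" f x] by (simp add: comp_def)

lemma lift_init_init_lin:
  assumes "2 \<le> k" "x \<in> free_on (Adm_wt k)"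
  shows "lift_init k (init_lin x) = x"
  unfolding lift_init_def init_lin_def frag_extend_frag_of_comp
  using assms bij_betw_inv_into_left[OF bij_betw_init[OF assms(1)]]
  by (intro frag_extend_frag_of_id_on) (auto simp: free_on_def)

lemma init_lin_lift_init:
  assumes "2 \<le> k" "x \<in> free_on {c. weight c < k}"
  shows "init_lin (lift_init k x) = x"
  unfolding lift_init_def init_lin_def frag_extend_frag_of_comp
  using assms bij_betw_inv_into_right[OF bij_betw_init[OF assms(1)]]
  by (intro frag_extend_frag_of_id_on) (auto simp: free_on_def)

lemma frag_extend_mem_free_on:
  assumes "x \<in> free_on S" "\<And>a. a \<in> S \<Longrightarrow> f a \<in> free_on T"
  shows "frag_extend f x \<in> free_on T"
  using assms keys_frag_extend[of f x] unfolding free_on_def by blast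

lemma lift_init_mem_free_on:
  assumes "2 \<le> k" "x \<in> free_on {c. weight c < k}"
  shows "lift_init k x \<in> free_on (Adm_wt k)"
  unfolding lift_init_def
  using assms(2)
proof (rule frag_extend_mem_free_on)
  fix c assume "c \<in> {c. weight c < k}"
  then have "inv_into (Adm_wt k) init c \<in> Adm_wt k"
    using bij_betw_init[OF assms(1)] by (metis bij_betw_imp_surj_on inv_into_into)
  then show "frag_of (inv_into (Adm_wt k) init c) \<in> free_on (Adm_wt k)"
    by (simp add: free_on_def)
qed

section \<open>Recursive construction on duality classes\<close>

lemma cls_eq_cls_empty_iff: "cls a = cls empty_adm \<longleftrightarrow> a = empty_adm"
  using dual_eq_empty_iff[of empty_adm] dual_eq_empty_iff[of a] by (auto simp: cls_eq_iff)

lemma class_weight_ge_2: "c \<in> Class_star \<Longrightarrow> 2 \<le> class_weight c"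
  by (cases c rule: class_cases) (auto simp: Class_star_def cls_eq_cls_empty_iff weight_ge_2)

text \<open>The support lies among the classes of \<open>init a\<close>, \<open>mid a\<close> and
  \<open>fin a\<close>, each lighter than \<open>a\<close>. This makes the recursion below
  well-founded.\<close>

lemma class_weight_alpha_class_less:
  assumes "c \<in> Class_star" "d \<in> Poly_Mapping.keys (alpha_class c)"
  shows "class_weight d < class_weight c"
proof -
  obtain a where c: "c = cls a" by (rule class_cases)
  then have a: "a \<noteq> empty_adm" using assms by (auto simp: Class_star_def)
  have "Poly_Mapping.keys (alpha_class c) \<subseteq> {cls (init a), cls (mid a), cls (fin a)}"
    unfolding c alpha_class_cls
    using keys_add[of "frag_of (cls (init a)) + frag_of (cls (mid a))" "frag_of (cls (fin a))"]
      keys_add[of "frag_of (cls (init a))" "frag_of (cls (mid a))"] by auto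
  with assms(2) show ?thesis
    using weight_init_less[OF a] weight_mid_less[OF a] weight_fin_less[OF a] by (auto simp: c)
qed

text \<open>As a \<open>fundef_cong\<close> rule it confines the recursive calls hidden in
  \<open>frag_extend delta_class\<close> to the support of \<open>alpha_class c\<close>, so
  termination only concerns classes known to be lighter.\<close>

lemma frag_extend_cong [fundef_cong]:
  "x = y \<Longrightarrow> (\<And>a. a \<in> Poly_Mapping.keys y \<Longrightarrow> f a = g a) \<Longrightarrow> frag_extend f x = frag_extend g y"
  by (auto intro: frag_extend_eq)

text \<open>Applying \<open>lift_init\<close> solves the required equation for the component of the
  weight of \<open>c\<close>. The other branch is reached only by the class of
  \<open>empty_adm\<close>.\<close>

function delta_class :: "adm_class \<Rightarrow> (adm \<Rightarrow>\<^sub>0 int)" where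
  "delta_class c = (if c \<in> Class_star
     then lift_init (class_weight c) (frag_extend delta_class (alpha_class c))
     else frag_of empty_adm)"
  by auto
termination
  by (relation "measure class_weight") (auto intro: class_weight_alpha_class_less)

declare delta_class.simps [simp del]

lemma delta_class_empty: "delta_class (cls empty_adm) = frag_of empty_adm"
  by (simp add: delta_class.simps[of "cls empty_adm"] Class_star_def)

text \<open>Places the recursive value where \<open>lift_init\<close> inverts
  \<open>init_lin\<close>. The assumption on \<open>f\<close> covers lighter classes only, so that
  an induction hypothesis can discharge it.\<close>

lemma frag_extend_mem_weight_less:
  assumes "c \<in> Class_star"
    and "\<And>d. class_weight d < class_weight c \<Longrightarrow> f d \<in> free_on (Adm_wt (class_weight d))"
  shows "frag_extend f (alpha_class c) \<in> free_on {b. weight b < class_weight c}"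
proof (rule frag_extend_mem_free_on)
  show "alpha_class c \<in> free_on {d. class_weight d < class_weight c}"
    using class_weight_alpha_class_less[OF assms(1)] by (auto simp: free_on_def)
qed (use assms(2) in \<open>fastforce simp: free_on_def Adm_wt_def\<close>)

lemma delta_class_mem: "delta_class c \<in> free_on (Adm_wt (class_weight c))"
proof (induction c rule: measure_induct_rule[of class_weight])
  case (less c)
  show ?case
  proof (cases "c \<in> Class_star")
    case True
    then show ?thesis
      using lift_init_mem_free_on[OF class_weight_ge_2 frag_extend_mem_weight_less] less
      by (simp add: delta_class.simps[of c])
  next
    case False
    moreover have "weight empty_adm = 0" by (simp add: weight_eq_0_iff)
    ultimately show ?thesis
      by (auto simp: delta_class_empty free_on_def Adm_wt_def Class_star_def)
  qed
qed

lemma init_lin_delta_class: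
  assumes "c \<in> Class_star"
  shows "init_lin (delta_class c) = frag_extend delta_class (alpha_class c)"
  using init_lin_lift_init[OF class_weight_ge_2 frag_extend_mem_weight_less, OF assms assms]
  by (simp add: delta_class.simps[of c] assms delta_class_mem)

section \<open>Linear maps and the commuting square on basis elements\<close>

lemma Z_linear_frag_extend: "Z_linear (frag_extend f)"
  by (simp add: Z_linear_iff frag_extend_add frag_extend_cmul)

lemma Z_linear_minus:
  assumes "Z_linear f"
  shows "f (x - y) = f x - f y"
proof -
  have "f (x + frag_cmul (- 1) y) = f x + frag_cmul (- 1) (f y)"
    using assms unfolding Z_linear_iff by metis
  then show ?thesis by simp
qed

text \<open>Basis elements generate \<open>free_on S\<close> under differences, which linear maps
  respect.\<close>

lemma Z_linear_eq_on_free_on: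
  assumes "Z_linear f" "Z_linear g" "\<And>a. a \<in> S \<Longrightarrow> f (frag_of a) = g (frag_of a)"
    and "x \<in> free_on S"
  shows "f x = g x"
proof -
  have "Poly_Mapping.keys x \<subseteq> S" using assms(4) by (simp add: free_on_def)
  then show ?thesis
  proof (induction x rule: frag_induction)
    case zero
    then show ?case
      using Z_linear_minus[OF assms(1), of 0 0] Z_linear_minus[OF assms(2), of 0 0] by simp
  qed (simp_all add: assms(1-3) Z_linear_minus)
qed

lemma Z_linear_eq_frag_extend:
  assumes "Z_linear f"
  shows "f = frag_extend (\<lambda>a. f (frag_of a))"
proof
  fix x
  show "f x = frag_extend (\<lambda>a. f (frag_of a)) x"
    by (rule Z_linear_eq_on_free_on[OF assms Z_linear_frag_extend, of UNIV])
      (simp_all add: free_on_def)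
qed

lemma Z_linear_comp: "Z_linear f \<Longrightarrow> Z_linear g \<Longrightarrow> Z_linear (\<lambda>x. f (g x))"
  by (simp add: Z_linear_iff)

lemma Z_linear_init_lin: "Z_linear init_lin"
  unfolding init_lin_def by (rule Z_linear_frag_extend)

text \<open>Removes the domain restrictions: both composites are \<open>undefined\<close> off
  \<open>free_on Class_star\<close>, and on it they agree with linear maps, which can be compared on
  basis elements.\<close>

lemma commutes_iff_on_basis:
  assumes lin: "Z_linear \<delta>" and gr: "graded \<delta>"
  shows "compose (free_on Class_star) mu (induced \<delta>) = compose (free_on Class_star) \<delta> alpha
    \<longleftrightarrow> (\<forall>c\<in>Class_star. init_lin (\<delta> (frag_of c)) = \<delta> (alpha_class c))" (is "?l \<longleftrightarrow> ?r")
proof -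
  \<comment> \<open>By \<open>induced_mem\<close> the argument lies in the domain of
    \<open>mu\<close>, so its restriction has no effect.\<close>
  have "mu (induced \<delta> x) = init_lin (\<delta> x)" if "x \<in> free_on Class_star" for x
    using funcset_mem[OF induced_mem[OF lin gr] that] that by (simp add: mu_def induced_def)
  then have "?l \<longleftrightarrow> (\<forall>x\<in>free_on Class_star. init_lin (\<delta> x) = \<delta> (frag_extend alpha_class x))"
    by (auto simp: fun_eq_iff compose_def restrict_def alpha_def)
  also have "\<dots> \<longleftrightarrow> ?r"
  proof
    assume l: "\<forall>x\<in>free_on Class_star. init_lin (\<delta> x) = \<delta> (frag_extend alpha_class x)"
    show ?r
    proof
      fix c assume "c \<in> Class_star"
      then have "frag_of c \<in> free_on Class_star" by (simp add: free_on_def)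
      with l show "init_lin (\<delta> (frag_of c)) = \<delta> (alpha_class c)" by fastforce
    qed
  next
    assume r: ?r
    show "\<forall>x\<in>free_on Class_star. init_lin (\<delta> x) = \<delta> (frag_extend alpha_class x)"
    proof
      fix x assume "x \<in> free_on Class_star"
      then show "init_lin (\<delta> x) = \<delta> (frag_extend alpha_class x)"
        by (rule Z_linear_eq_on_free_on[OF Z_linear_comp[OF Z_linear_init_lin lin]
              Z_linear_comp[OF lin Z_linear_frag_extend], rotated]) (use r in simp)
    qed
  qed
  finally show ?thesis .
qed

lemma graded_frag_extend_delta_class: "graded (frag_extend delta_class)"
  unfolding graded_def
proof (intro allI image_subsetI)
  fix k x assume "x \<in> free_on (Class_wt k)"
  then show "frag_extend delta_class x \<in> free_on (Adm_wt k)"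
    by (rule frag_extend_mem_free_on) (use delta_class_mem in \<open>auto simp: Class_wt_def\<close>)
qed

text \<open>The grading places the value at \<open>c\<close> in weight
  \<open>class_weight c\<close>, where \<open>lift_init\<close> undoes \<open>init_lin\<close>. The
  value is thus determined by those on lighter classes, and induction on the weight applies.\<close>

lemma delta_class_unique:
  assumes lin: "Z_linear \<delta>" and gr: "graded \<delta>"
    and empty: "\<delta> (frag_of (cls empty_adm)) = frag_of empty_adm"
    and eq: "\<And>c. c \<in> Class_star \<Longrightarrow> init_lin (\<delta> (frag_of c)) = \<delta> (alpha_class c)"
  shows "\<delta> (frag_of c) = delta_class c"
proof (induction c rule: measure_induct_rule[of class_weight])
  case (less c)
  show ?case
  proof (cases "c \<in> Class_star")
    case True
    have "frag_of c \<in> free_on (Class_wt (class_weight c))"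
      by (simp add: free_on_def Class_wt_def)
    then have "\<delta> (frag_of c) \<in> free_on (Adm_wt (class_weight c))"
      using gr by (auto simp: graded_def)
    then have "\<delta> (frag_of c) = lift_init (class_weight c) (\<delta> (alpha_class c))"
      using lift_init_init_lin[OF class_weight_ge_2[OF True]] eq[OF True] by metis
    also have "\<delta> (alpha_class c) = frag_extend delta_class (alpha_class c)"
      \<comment> \<open>Written as a \<open>frag_extend\<close>, \<open>\<delta>\<close> enters only
        through the support of \<open>alpha_class c\<close>, where the induction hypothesis
        holds.\<close>
      by (subst Z_linear_eq_frag_extend[OF lin], rule frag_extend_cong[OF refl])
        (use less class_weight_alpha_class_less[OF True] in blast)
    finally show ?thesis using True by (simp add: delta_class.simps[of c])
  next
    case False
    then show ?thesis using empty by (simp add: delta_class_empty Class_star_def)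
  qed
qed

theorem theorem10:
  shows "(\<exists>!\<delta> :: (adm_class \<Rightarrow>\<^sub>0 int) \<Rightarrow> (adm \<Rightarrow>\<^sub>0 int).
            Z_linear \<delta> \<and> graded \<delta> \<and> \<delta> (frag_of (cls empty_adm)) = frag_of empty_adm \<and>
            compose (free_on Class_star) mu (induced \<delta>) = compose (free_on Class_star) \<delta> alpha)
       \<and> (\<forall>\<delta> :: (adm_class \<Rightarrow>\<^sub>0 int) \<Rightarrow> (adm \<Rightarrow>\<^sub>0 int).
            Z_linear \<delta> \<and> graded \<delta> \<and> \<delta> (frag_of (cls empty_adm)) = frag_of empty_adm \<longrightarrow>
            (compose (free_on Class_star) mu (induced \<delta>) = compose (free_on Class_star) \<delta> alpha
             \<longleftrightarrow>
             (\<forall>a. a \<noteq> empty_adm \<longrightarrow>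
                init_lin (\<delta> (frag_of (cls a))) =
                  \<delta> (frag_of (cls (init a))) + \<delta> (frag_of (cls (mid a)))
                    + \<delta> (frag_of (cls (fin a))))))"
proof (intro conjI allI impI)
  show "\<exists>!\<delta>. Z_linear \<delta> \<and> graded \<delta> \<and> \<delta> (frag_of (cls empty_adm)) = frag_of empty_adm \<and>
      compose (free_on Class_star) mu (induced \<delta>) = compose (free_on Class_star) \<delta> alpha"
  proof (rule ex1I[of _ "frag_extend delta_class"])
    show "Z_linear (frag_extend delta_class) \<and> graded (frag_extend delta_class) \<and>
        frag_extend delta_class (frag_of (cls empty_adm)) = frag_of empty_adm \<and>
        compose (free_on Class_star) mu (induced (frag_extend delta_class))
          = compose (free_on Class_star) (frag_extend delta_class) alpha"
      using commutes_iff_on_basis[OF Z_linear_frag_extend graded_frag_extend_delta_class]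
      by (simp add: Z_linear_frag_extend graded_frag_extend_delta_class init_lin_delta_class
          delta_class_empty)
  next
    fix \<delta>
    assume *: "Z_linear \<delta> \<and> graded \<delta> \<and> \<delta> (frag_of (cls empty_adm)) = frag_of empty_adm \<and>
      compose (free_on Class_star) mu (induced \<delta>) = compose (free_on Class_star) \<delta> alpha"
    then have "\<delta> (frag_of c) = delta_class c" for c
      using commutes_iff_on_basis[of \<delta>] by (intro delta_class_unique) auto
    then show "\<delta> = frag_extend delta_class"
      using * Z_linear_eq_frag_extend[of \<delta>] by simp
  qed
next
  fix \<delta> :: "(adm_class \<Rightarrow>\<^sub>0 int) \<Rightarrow> (adm \<Rightarrow>\<^sub>0 int)"
  assume *: "Z_linear \<delta> \<and> graded \<delta> \<and> \<delta> (frag_of (cls empty_adm)) = frag_of empty_adm"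
  \<comment> \<open>Every class has a representative, and \<open>empty_adm\<close> is alone in its
    class, so classes in \<open>Class_star\<close> can be replaced by non-empty
    compositions.\<close>
  have "(\<forall>c\<in>Class_star. P c) \<longleftrightarrow> (\<forall>a. a \<noteq> empty_adm \<longrightarrow> P (cls a))" for P
    unfolding Class_star_def by (metis DiffD2 DiffI UNIV_I class_cases cls_eq_cls_empty_iff
        singletonD singletonI)
  \<comment> \<open>Additivity splits \<open>\<delta> (alpha_class (cls a))\<close> into the three
    terms of the explicit formula.\<close>
  moreover have "\<delta> (x + y) = \<delta> x + \<delta> y" for x y
    using * by (simp add: Z_linear_iff)
  ultimately show "compose (free_on Class_star) mu (induced \<delta>) = compose (free_on Class_star) \<delta> alpha
      \<longleftrightarrow> (\<forall>a. a \<noteq> empty_adm \<longrightarrow> init_lin (\<delta> (frag_of (cls a))) =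
        \<delta> (frag_of (cls (init a))) + \<delta> (frag_of (cls (mid a))) + \<delta> (frag_of (cls (fin a))))"
    using * commutes_iff_on_basis[of \<delta>] by (simp add: alpha_class_cls)
qed

end
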